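(* Let $M=(U,C,E,\vec N,\vec I,\vec R)$ be a market with $m=|C|$ size-interchangeable bidders and let $I^*=\max_{j\in C} I_j$. Let $X$ be any allocation produced by the greedy algorithm run with the bidders ordered in descending order of $R_j/\sqrt{I_j}$, and let $W$ be its set of winners. Then the welfare of $X$ is within a factor $m\sqrt{I^*}$ of the welfare of a welfare-maximizing allocation; that is, if $\mathrm{OPT}$ is the set of winners of a welfare-maximizing allocation, then $$m\sqrt{I^*}\,\sum_{j\in W} R_j\;\ge\;\sum_{j\in \mathrm{OPT}} R_j .$$
   Context: A market (centralized combinatorial matching market) $M=(U,C,E,\vec N,\vec I,\vec R)$ consists of a finite set $U$ of $n$ types of goods, a finite set $C$ of $m$ bidders, a set $E\subseteq U\times C$ of edges indicating which goods are of interest to which bidders, positive integers $N_i$ ($i\in U$; number of copies of good $i$), positive integers $I_j$ ($j\in C$; total number of goods demanded by bidder $j$) and rewards $R_j>0$ ($j\in C$). An allocation is a matrix $X=(x_{ij})$ with $x_{ij}\in\mathbb{Z}_{\ge0}$ and $x_{ij}=0$ whenever $(i,j)\notin E$; it is feasible if $\sum_{j} x_{ij}\le N_i$ for all $i$. Bidders are size-interchangeable: bidder $j$ obtains reward $R_j$ if $\sum_{i:(i,j)\in E}x_{ij}\ge I_j$ (in which case $j$ is a winner of $X$), and $0$ otherwise. The welfare (value) of a feasible allocation is the sum of $R_j$ over its winners; a welfare-maximizing allocation is a feasible allocation of maximum welfare. Greedy algorithm: start from $x_{ij}=0$ for all $i,j$. Process the bidders one at a time in the given order (ties broken arbitrarily).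 When processing $j$, let $U_j=\{i:(i,j)\in E,\ \sum_{j'}x_{ij'}<N_i\}$ be the goods of interest to $j$ that are still in supply. If the total remaining supply $\sum_{i\in U_j}(N_i-\sum_{j'}x_{ij'})$ is at least $I_j$, then go through the goods $i\in U_j$ in an arbitrary order, setting $x_{ij}$ to the minimum of $j$'s still unmet demand $I_j-\sum_{i'}x_{i'j}$ and the remaining supply $N_i-\sum_{j'}x_{ij'}$ of $i$ (so that $j$ ends up with exactly $I_j$ goods); otherwise $j$ is given nothing. *)

theory Defs
  imports Complex_Main
begin

record ('u, 'c) market =
  goods :: "'u set"
  bidders :: "'c set"
  edges :: "('u \<times> 'c) set"
  copies :: "'u \<Rightarrow> nat"
  demand :: "'c \<Rightarrow> nat"
  reward :: "'c \<Rightarrow> real"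

definition is_market :: "('u, 'c) market \<Rightarrow> bool" where
  "is_market M \<longleftrightarrow>
     finite (goods M) \<and> finite (bidders M) \<and> edges M \<subseteq> goods M \<times> bidders M \<and>
     (\<forall>i\<in>goods M. 0 < copies M i) \<and>
     (\<forall>j\<in>bidders M. 0 < demand M j) \<and>
     (\<forall>j\<in>bidders M. 0 < reward M j)"

type_synonym ('u, 'c) allocation = "'u \<Rightarrow> 'c \<Rightarrow> nat"

definition is_allocation :: "('u, 'c) market \<Rightarrow> ('u, 'c) allocation \<Rightarrow> bool" where
  "is_allocation M X \<longleftrightarrow> (\<forall>i j. (i, j) \<notin> edges M \<longrightarrow> X i j = 0)"

definition allocated :: "('u, 'c) market \<Rightarrow> ('u, 'c) allocation \<Rightarrow> 'u \<Rightarrow> nat" where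
  "allocated M X i = (\<Sum>j\<in>bidders M. X i j)"

definition feasible :: "('u, 'c) market \<Rightarrow> ('u, 'c) allocation \<Rightarrow> bool" where
  "feasible M X \<longleftrightarrow> is_allocation M X \<and> (\<forall>i\<in>goods M. allocated M X i \<le> copies M i)"

definition winners :: "('u, 'c) market \<Rightarrow> ('u, 'c) allocation \<Rightarrow> 'c set" where
  "winners M X =
     {j \<in> bidders M. demand M j \<le> (\<Sum>i\<in>{i \<in> goods M. (i, j) \<in> edges M}. X i j)}"

definition welfare :: "('u, 'c) market \<Rightarrow> ('u, 'c) allocation \<Rightarrow> real" where
  "welfare M X = (\<Sum>j\<in>winners M X. reward M j)"

definition welfare_maximizing :: "('u, 'c) market \<Rightarrow> ('u, 'c) allocation \<Rightarrow> bool" where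
  "welfare_maximizing M X \<longleftrightarrow>
     feasible M X \<and> (\<forall>Y. feasible M Y \<longrightarrow> welfare M Y \<le> welfare M X)"

definition available_goods :: "('u, 'c) market \<Rightarrow> ('u, 'c) allocation \<Rightarrow> 'c \<Rightarrow> 'u set" where
  "available_goods M X j =
     {i \<in> goods M. (i, j) \<in> edges M \<and> allocated M X i < copies M i}"

text \<open>
  The truncated subtractions on natural numbers here and in \<open>greedy_step\<close> are exact along
  a greedy run: no good is ever over-allocated and no bidder ever gets more than its demand.
\<close>

definition give_good ::
    "('u, 'c) market \<Rightarrow> 'c \<Rightarrow> 'u \<Rightarrow> ('u, 'c) allocation \<Rightarrow> ('u, 'c) allocation" where
  "give_good M j i X =
     X(i := (X i)(j := min (demand M j - (\<Sum>i'\<in>goods M. X i' j))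
                           (copies M i - allocated M X i)))"

text \<open>
  Processing one bidder, as a relation: the list \<open>us\<close> is the arbitrary order in which the
  available goods (those available before the bidder gets anything) are traversed.
\<close>

definition greedy_step ::
    "('u, 'c) market \<Rightarrow> 'c \<Rightarrow> ('u, 'c) allocation \<Rightarrow> ('u, 'c) allocation \<Rightarrow> bool" where
  "greedy_step M j X Y \<longleftrightarrow>
     (if demand M j \<le> (\<Sum>i\<in>available_goods M X j. copies M i - allocated M X i)
      then \<exists>us. distinct us \<and> set us = available_goods M X j \<and> Y = fold (give_good M j) us X
      else Y = X)"

inductive greedy_run ::
    "('u, 'c) market \<Rightarrow> 'c list \<Rightarrow> ('u, 'c) allocation \<Rightarrow> ('u, 'c) allocation \<Rightarrow> bool"
  for M where
  Nil: "greedy_run M [] X X"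
| Cons: "greedy_step M j X Y \<Longrightarrow> greedy_run M js Y Z \<Longrightarrow> greedy_run M (j # js) X Z"

definition greedy_output :: "('u, 'c) market \<Rightarrow> 'c list \<Rightarrow> ('u, 'c) allocation \<Rightarrow> bool" where
  "greedy_output M js X \<longleftrightarrow> greedy_run M js (\<lambda>i j. 0) X"

text \<open>Ties may be broken arbitrarily, so several lists may qualify.\<close>

definition descending_ratio_order :: "('u, 'c) market \<Rightarrow> 'c list \<Rightarrow> bool" where
  "descending_ratio_order M js \<longleftrightarrow>
     distinct js \<and> set js = bidders M \<and>
     sorted_wrt (\<lambda>j k. reward M j / sqrt (real (demand M j))
                     \<ge> reward M k / sqrt (real (demand M k))) js"

end

theory Submission
  imports Defs
begin

text \<open>
  Every winner of any feasible allocation could be served on its own from the full supply.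
  The greedy algorithm serves the first such bidder \<open>k\<close> of its order, because nothing has been
  handed out before, so every winner \<open>j\<close> of the optimum satisfies
  \<open>R\<^sub>j / sqrt I\<^sub>j \<le> R\<^sub>k / sqrt I\<^sub>k\<close> and hence \<open>R\<^sub>j \<le> sqrt I\<^sup>* R\<^sub>k\<close>.  Summing over the at most \<open>m\<close>
  winners of the optimum gives the bound.
\<close>

lemma give_good_other_bidder: "k \<noteq> j \<Longrightarrow> give_good M j i X i' k = X i' k"
  by (simp add: give_good_def)

lemma fold_give_good_other_bidder: "k \<noteq> j \<Longrightarrow> fold (give_good M j) us X i k = X i k"
  by (induction us arbitrary: X) (simp_all add: give_good_other_bidder)

lemma fold_give_good_other_good: "i \<notin> set us \<Longrightarrow> fold (give_good M j) us X i = X i"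
  by (induction us arbitrary: X) (simp_all add: give_good_def)

text \<open>Induction on the traversal order: each good contributes its whole remaining supply or
  exactly the unmet demand. Since \<open>give_good\<close> overwrites the entry instead of adding to
  it, the entries of the goods still to be visited have to start at 0; only then does no visit lose
  goods granted before.\<close>

lemma fold_give_good_total:
  assumes "finite (goods M)" "distinct us" "set us \<subseteq> goods M" "\<forall>i\<in>set us. X i j = 0"
  shows "min (demand M j) ((\<Sum>i\<in>goods M. X i j) + (\<Sum>i\<in>set us. copies M i - allocated M X i))
           \<le> (\<Sum>i\<in>goods M. fold (give_good M j) us X i j)"
  using assms
proof (induction us arbitrary: X)
  case Nil
  then show ?case by simp
next
  case (Cons u us)
  define Y where "Y = give_good M j u X"
  have u: "u \<in> goods M" "u \<notin> set us" "X u j = 0"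
    using Cons.prems by auto
  have Y: "Y i = X i" if "i \<noteq> u" for i
    using that by (simp add: Y_def give_good_def)
  have alloc: "allocated M Y i = allocated M X i" if "i \<in> set us" for i
    using that u by (metis Y allocated_def)
  have IH: "min (demand M j) ((\<Sum>i\<in>goods M. Y i j) + (\<Sum>i\<in>set us. copies M i - allocated M X i))
              \<le> (\<Sum>i\<in>goods M. fold (give_good M j) us Y i j)"
  proof -
    have "\<forall>i\<in>set us. Y i j = 0"
      using Cons.prems Y u by (metis list.set_intros(2))
    then show ?thesis
      using Cons.IH[of Y] Cons.prems alloc by simp
  qed
  have "(\<Sum>i\<in>goods M. Y i j) = Y u j + (\<Sum>i\<in>goods M - {u}. Y i j)"
    using Cons.prems(1) u by (simp add: sum.remove)
  also have "(\<Sum>i\<in>goods M - {u}. Y i j) = (\<Sum>i\<in>goods M - {u}. X i j)"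
    using Y by (intro sum.cong) auto
  also have "\<dots> = (\<Sum>i\<in>goods M. X i j)"
    using Cons.prems(1) u by (simp add: sum.remove)
  finally have "(\<Sum>i\<in>goods M. Y i j) =
      min (demand M j - (\<Sum>i\<in>goods M. X i j)) (copies M u - allocated M X u)
        + (\<Sum>i\<in>goods M. X i j)"
    by (simp add: Y_def give_good_def)
  \<comment> \<open>If the demand attains the minimum, the total after \<open>u\<close> is already
    at least \<open>demand M j\<close>, also when the subtraction truncates; otherwise the supply of
    \<open>u\<close> moves from the second summand of the bound to the first.\<close>
  then show ?case
    using IH u by (simp add: Y_def min_def split: if_splits)
qed

lemma greedy_step_other_bidder: "greedy_step M j X Y \<Longrightarrow> k \<noteq> j \<Longrightarrow> Y i k = X i k"
  by (auto simp: greedy_step_def fold_give_good_other_bidder split: if_splits)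

lemma greedy_run_other_bidder: "greedy_run M js X Z \<Longrightarrow> k \<notin> set js \<Longrightarrow> Z i k = X i k"
  by (induction rule: greedy_run.induct) (auto simp: greedy_step_other_bidder)

lemma greedy_step_winner:
  assumes fin: "finite (goods M)" and j: "j \<in> bidders M" and step: "greedy_step M j X Y"
    and enough: "demand M j \<le> (\<Sum>i\<in>available_goods M X j. copies M i - allocated M X i)"
    and zero: "\<forall>i. X i j = 0"
  shows "j \<in> winners M Y"
proof -
  obtain us where us: "distinct us" "set us = available_goods M X j"
      "Y = fold (give_good M j) us X"
    using step enough by (auto simp: greedy_step_def)
  have "set us \<subseteq> goods M"
    using us by (auto simp: available_goods_def)
  then have "demand M j \<le> (\<Sum>i\<in>goods M. Y i j)"
    using fold_give_good_total[of M us X j] fin us enough zero by simp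
  \<comment> \<open>Goods without an edge to \<open>j\<close> are never traversed, so their entries
    keep the value 0.\<close>
  also have "\<dots> = (\<Sum>i\<in>{i \<in> goods M. (i, j) \<in> edges M}. Y i j)"
  proof (rule sum.mono_neutral_right)
    show "\<forall>i\<in>goods M - {i \<in> goods M. (i, j) \<in> edges M}. Y i j = 0"
      using us zero fold_give_good_other_good[of _ us M j X] by (auto simp: available_goods_def)
  qed (use fin in auto)
  finally show ?thesis
    using j by (simp add: winners_def)
qed

text \<open>Bidders that cannot be served leave the allocation at zero, so the induction can keep
  the zero start. The first servable bidder wins and is \<open>j\<close> itself (whence
  \<open>reflp P\<close>) or precedes \<open>j\<close> in the order.\<close>

lemma greedy_first_servable_wins:
  assumes "finite (goods M)" "greedy_run M js (\<lambda>i j. 0) X" "distinct js" "set js \<subseteq> bidders M"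
    and "sorted_wrt P js" "reflp P" "j \<in> set js"
    and "demand M j \<le> (\<Sum>i\<in>available_goods M (\<lambda>i j. 0) j. copies M i)"
  shows "\<exists>k\<in>winners M X. P k j"
  using assms(2-)
proof (induction js)
  case Nil
  then show ?case by simp
next
  case (Cons k js)
  obtain Y where Y: "greedy_step M k (\<lambda>i j. 0) Y" "greedy_run M js Y X"
    using Cons.prems(1) by (auto elim: greedy_run.cases)
  show ?case
  proof (cases "demand M k \<le> (\<Sum>i\<in>available_goods M (\<lambda>i j. 0) k. copies M i)")
    case True
    then have "k \<in> winners M Y"
      using assms(1) Cons.prems Y(1)
      by (intro greedy_step_winner[of M k "\<lambda>i j. 0"]) (auto simp: allocated_def)
    \<comment> \<open>As \<open>js\<close> does not contain \<open>k\<close>, the rest of the run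
      leaves the entries of \<open>k\<close> alone.\<close>
    then have "k \<in> winners M X"
      using greedy_run_other_bidder[OF Y(2), of k] Cons.prems by (simp add: winners_def)
    moreover have "P k j"
      using Cons.prems by (auto simp: reflp_def)
    ultimately show ?thesis by blast
  next
    case False
    then have "Y = (\<lambda>i j. 0)"
      using Y(1) by (simp add: greedy_step_def allocated_def)
    \<comment> \<open>Here \<open>k\<close> is not servable but \<open>j\<close> is, so
      \<open>j\<close> lies in the tail.\<close>
    then show ?thesis
      using Cons.IH Cons.prems Y(2) False by auto
  qed
qed

lemma feasible_winner_servable:
  assumes M: "is_market M" and "feasible M Y" and j: "j \<in> winners M Y"
  shows "demand M j \<le> (\<Sum>i\<in>available_goods M (\<lambda>i j. 0) j. copies M i)"
proof -
  have "Y i j \<le> copies M i" if "i \<in> goods M" for i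
  proof -
    have "Y i j \<le> allocated M Y i"
      unfolding allocated_def
      using M j by (intro member_le_sum) (auto simp: is_market_def winners_def)
    then show ?thesis
      using assms(2) that by (fastforce simp: feasible_def)
  qed
  then have "(\<Sum>i\<in>{i \<in> goods M. (i, j) \<in> edges M}. Y i j)
      \<le> (\<Sum>i\<in>{i \<in> goods M. (i, j) \<in> edges M}. copies M i)"
    by (intro sum_mono) auto
  \<comment> \<open>All copy numbers are positive, so at the start no good is exhausted.\<close>
  moreover have "available_goods M (\<lambda>i j. 0) j = {i \<in> goods M. (i, j) \<in> edges M}"
    using M by (auto simp: available_goods_def allocated_def is_market_def)
  ultimately show ?thesis
    using j by (simp add: winners_def)
qed

theorem theorem3p2:
  fixes M :: "('u, 'c) market"
    and js :: "'c list"
    and X Y :: "('u, 'c) allocation"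
  assumes "is_market M"
    and "descending_ratio_order M js"
    and "greedy_output M js X"
    and "welfare_maximizing M Y"
  shows "real (card (bidders M)) * sqrt (real (Max (demand M ` bidders M)))
           * (\<Sum>j\<in>winners M X. reward M j)
         \<ge> (\<Sum>j\<in>winners M Y. reward M j)"
proof -
  let ?s = "sqrt (real (Max (demand M ` bidders M)))"
  let ?W = "\<Sum>j\<in>winners M X. reward M j"
  have fin: "finite (goods M)" "finite (bidders M)"
    and pos: "\<And>j. j \<in> bidders M \<Longrightarrow> 0 < demand M j" "\<And>j. j \<in> bidders M \<Longrightarrow> 0 < reward M j"
    using assms(1) by (auto simp: is_market_def)
  have sub: "winners M Z \<subseteq> bidders M" for Z
    by (auto simp: winners_def)
  have finW: "finite (winners M Z)" for Z
    using sub fin(2) by (rule finite_subset)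
  have W: "0 \<le> ?W"
    using sub pos(2) by (intro sum_nonneg) (force intro: less_imp_le)
  have bound: "reward M j \<le> ?s * ?W" if j: "j \<in> winners M Y" for j
  proof -
    have jb: "j \<in> bidders M"
      using j sub by blast
    have "demand M j \<le> (\<Sum>i\<in>available_goods M (\<lambda>i j. 0) j. copies M i)"
      using feasible_winner_servable assms(1,4) j by (auto simp: welfare_maximizing_def)
    then obtain k where k: "k \<in> winners M X"
        "reward M k / sqrt (real (demand M k)) \<ge> reward M j / sqrt (real (demand M j))"
      using greedy_first_servable_wins[of M js X
          "\<lambda>k j. reward M k / sqrt (real (demand M k)) \<ge> reward M j / sqrt (real (demand M j))" j]
        fin(1) assms(2,3) jb
      by (auto simp: descending_ratio_order_def greedy_output_def reflp_def)
    have kb: "k \<in> bidders M"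
      using k sub by blast
    have "reward M j = sqrt (real (demand M j)) * (reward M j / sqrt (real (demand M j)))"
      using pos(1)[OF jb] by simp
    also have "\<dots> \<le> ?s * (reward M k / sqrt (real (demand M k)))"
      using jb fin(2) pos(2)[OF jb] k(2) by (intro mult_mono) auto
    \<comment> \<open>A positive integer demand has square root at least 1.\<close>
    also have "\<dots> \<le> ?s * (reward M k / 1)"
      using pos(1)[OF kb] pos(2)[OF kb] by (intro mult_left_mono divide_left_mono) auto
    also have "\<dots> \<le> ?s * ?W"
      using k(1) finW pos(2) sub
      by (simp, intro mult_left_mono member_le_sum) (force intro: less_imp_le)+
    finally show ?thesis .
  qed
  have "(\<Sum>j\<in>winners M Y. reward M j) \<le> real (card (winners M Y)) * (?s * ?W)"
    using bound by (rule sum_bounded_above)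
  \<comment> \<open>Enlarging the count to all bidders is sound because \<open>?s * ?W\<close> is
    nonnegative.\<close>
  also have "\<dots> \<le> real (card (bidders M)) * (?s * ?W)"
    using W sub fin(2) by (intro mult_right_mono) (auto intro: card_mono)
  finally show ?thesis
    by (simp add: mult.assoc)
qed

end
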